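(* Consider the joint alignment model described in the context, and assume $k \leq n^{o(1)}$. (a) If $n^{-1/4} \leq \delta \leq \frac{1}{2k}$, then any non-adaptive, possibly randomized, query algorithm making $o\!\left(\frac{n \log n}{\delta^2 k}\right)$ queries has success probability at most $\exp(-n^{\Omega(1)})$. (b) If $\frac{1}{2k} \leq \delta \leq \frac14$, then any non-adaptive, possibly randomized, query algorithm making $o\!\left(\frac{n \log n}{\delta}\right)$ queries has success probability at most $\exp(-n^{\Omega(1)})$.
   Context: Joint alignment model: $V = [n] = \{1,\dots,n\}$ is a set of items and $g : V \to \{0,1,\dots,k-1\}$ is an unknown labeling. For a pair of distinct items $x,y$, a query returns the noisy measurement $\tilde{f}(x,y) = (g(x) - g(y) + \eta_{xy}) \bmod k$, where the noise values $\eta_{xy}$ for distinct queried pairs are i.i.d. random variables on $\{0,\dots,k-1\}$ with $\Pr[\eta_{xy}=0] = \frac1k + \delta$ and $\Pr[\eta_{xy}=i] = \frac1k - \frac{\delta}{k-1}$ for each $i \neq 0$, for a parameter $\delta > 0$. Each pair is queried at most once. A non-adaptive algorithm chooses its (possibly random) set of queried pairs before seeing any answers. The algorithm has success probability $\varepsilon$ if for every labeling $g$ it outputs, with probability at least $\varepsilon$, a labeling equal to $g$ up to a global cyclic shift, i.e. a labeling $\hat g$ with $\hat g(v) = (g(v)+\alpha) \bmod k$ for all $v$ and some $\alpha \in \{0,\dots,k-1\}$. *)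

theory Defs
  imports "HOL-Probability.Probability" "HOL-Library.Landau_Symbols"
begin

definition noise_pmf :: "nat \<Rightarrow> real \<Rightarrow> nat pmf" where
  "noise_pmf k \<delta> = embed_pmf (\<lambda>i.
     if i = 0 then 1 / real k + \<delta>
     else if i < k then 1 / real k - \<delta> / (real k - 1)
     else 0)"

text \<open>
  The underlying function of \<^const>\<open>embed_pmf\<close> is a probability mass function in the whole
  admissible range of the parameters, so \<^const>\<open>noise_pmf\<close> is the intended distribution there.
\<close>

lemma pmf_noise_pmf:
  assumes "2 \<le> k" "0 \<le> \<delta>" "\<delta> \<le> 1 - 1 / real k"
  shows "pmf (noise_pmf k \<delta>) i =
    (if i = 0 then 1 / real k + \<delta>
     else if i < k then 1 / real k - \<delta> / (real k - 1)
     else 0)"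
proof -
  define p where "p = (\<lambda>i. if i = 0 then 1 / real k + \<delta>
     else if i < k then 1 / real k - \<delta> / (real k - 1) else 0)"
  have k1: "real k - 1 > 0" using assms by simp
  have "\<delta> / (real k - 1) \<le> 1 / real k"
  proof -
    have "\<delta> \<le> (real k - 1) / real k" using assms by (simp add: diff_divide_distrib)
    then have "\<delta> / (real k - 1) \<le> ((real k - 1) / real k) / (real k - 1)"
      using k1 by (intro divide_right_mono) auto
    then show ?thesis using k1 by simp
  qed
  then have nonneg: "p j \<ge> 0" for j using assms by (simp add: p_def)
  have "(\<Sum>j<k. p j) = p 0 + (\<Sum>j\<in>{1..<k}. p j)"
    using assms by (simp add: lessThan_atLeast0 sum.atLeast_Suc_lessThan)
  also have "(\<Sum>j\<in>{1..<k}. p j) = (\<Sum>j\<in>{1..<k}. 1 / real k - \<delta> / (real k - 1))"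
    by (rule sum.cong) (auto simp: p_def)
  also have "\<dots> = (real k - 1) * (1 / real k - \<delta> / (real k - 1))"
    using assms by (simp add: of_nat_diff)
  also have "\<dots> = (real k - 1) / real k - \<delta>"
    using k1 by (simp add: right_diff_distrib)
  also have "p 0 + \<dots> = 1" using assms by (simp add: p_def diff_divide_distrib)
  finally have sum1: "(\<Sum>j<k. p j) = 1" .
  have "(\<integral>\<^sup>+j. ennreal (p j) \<partial>count_space UNIV) = (\<integral>\<^sup>+j. ennreal (p j) \<partial>count_space {..<k})"
    by (rule nn_integral_count_space_eq) (use assms in \<open>auto simp: p_def\<close>)
  also have "\<dots> = (\<Sum>j<k. ennreal (p j))" by (simp add: nn_integral_count_space_finite)
  also have "\<dots> = 1" using nonneg sum1 by (simp add: sum_ennreal)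
  finally have "pmf (embed_pmf p) i = p i" using nonneg by (intro pmf_embed_pmf) auto
  then show ?thesis by (simp add: noise_pmf_def p_def)
qed

text \<open>
  A query is an ordered pair, because the measurement depends on the orientation; but each
  unordered pair of distinct items may be queried in at most one orientation.
\<close>

definition valid_queries :: "nat \<Rightarrow> (nat \<times> nat) set \<Rightarrow> bool" where
  "valid_queries n Q \<longleftrightarrow>
     (\<forall>(x, y)\<in>Q. x \<in> {1..n} \<and> y \<in> {1..n} \<and> x \<noteq> y \<and> (y, x) \<notin> Q)"

definition measurement :: "nat \<Rightarrow> (nat \<Rightarrow> nat) \<Rightarrow> (nat \<times> nat \<Rightarrow> nat) \<Rightarrow> nat \<times> nat \<Rightarrow> nat" where
  "measurement k g \<eta> = (\<lambda>(x, y). nat ((int (g x) - int (g y) + int (\<eta> (x, y))) mod int k))"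

text \<open>
  The restriction to the queried pairs is essential: outside of them the measurement function
  would reveal label differences without noise.
\<close>

definition answers_pmf :: "nat \<Rightarrow> real \<Rightarrow> (nat \<Rightarrow> nat) \<Rightarrow> (nat \<times> nat) set \<Rightarrow> (nat \<times> nat \<Rightarrow> nat) pmf" where
  "answers_pmf k \<delta> g Q =
     map_pmf (\<lambda>\<eta>. restrict (measurement k g \<eta>) Q) (Pi_pmf Q 0 (\<lambda>_. noise_pmf k \<delta>))"

text \<open>
  A randomized non-adaptive algorithm draws its set of queries independently of the answers; the
  output is then drawn from a distribution depending on the chosen queries and their answers.
  Internal randomness shared by the two phases is covered by conditioning on the chosen queries.
\<close>

record nonadaptive_algorithm =
  query_dist :: "(nat \<times> nat) set pmf"
  decoder :: "(nat \<times> nat) set \<Rightarrow> (nat \<times> nat \<Rightarrow> nat) \<Rightarrow> (nat \<Rightarrow> nat) pmf"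

definition makes_at_most_queries :: "nat \<Rightarrow> nonadaptive_algorithm \<Rightarrow> nat \<Rightarrow> bool" where
  "makes_at_most_queries n A m \<longleftrightarrow>
     (\<forall>Q \<in> set_pmf (query_dist A). valid_queries n Q \<and> card Q \<le> m)"

definition output_pmf :: "nat \<Rightarrow> real \<Rightarrow> nonadaptive_algorithm \<Rightarrow> (nat \<Rightarrow> nat) \<Rightarrow> (nat \<Rightarrow> nat) pmf" where
  "output_pmf k \<delta> A g =
     bind_pmf (query_dist A) (\<lambda>Q. bind_pmf (answers_pmf k \<delta> g Q) (\<lambda>f. decoder A Q f))"

definition equal_up_to_shift :: "nat \<Rightarrow> nat \<Rightarrow> (nat \<Rightarrow> nat) \<Rightarrow> (nat \<Rightarrow> nat) \<Rightarrow> bool" where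
  "equal_up_to_shift n k g h \<longleftrightarrow> (\<exists>\<alpha><k. \<forall>v\<in>{1..n}. h v = (g v + \<alpha>) mod k)"

definition has_success_probability :: "nat \<Rightarrow> nat \<Rightarrow> real \<Rightarrow> nonadaptive_algorithm \<Rightarrow> real \<Rightarrow> bool" where
  "has_success_probability n k \<delta> A \<epsilon> \<longleftrightarrow>
     (\<forall>g \<in> {1..n} \<rightarrow> {..<k}.
        measure_pmf.prob (output_pmf k \<delta> A g) {h. equal_up_to_shift n k g h} \<ge> \<epsilon>)"

end

theory Submission
  imports Defs "HOL-Real_Asymp.Real_Asymp"
begin

text \<open>
  Put the uniform prior on labelings with values in \<open>{0, 1}\<close> and fix the queried set \<open>Q\<close> with
  \<open>|Q| \<le> m\<close>. At least half of the items have degree at most \<open>D = 4 m / n\<close> in the query graph, and a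
  maximal independent set \<open>S\<close> among them satisfies \<open>|S| (D + 1) \<ge> n / 2\<close>. Once the labels outside
  \<open>S\<close> are revealed, recovering the labeling means solving \<open>|S|\<close> independent binary tests, each based
  on at most \<open>D\<close> samples of the noise. A single test errs with probability at least
  \<open>(1 - h)^(2 D) / 4\<close>, where \<open>h\<close> bounds the squared Hellinger distance
  \<open>(\<surd>p - \<surd>r)\<^sup>2\<close> between the noise and a shifted copy; here \<open>p = 1/k + \<delta>\<close> and
  \<open>r = 1/k - \<delta>/(k - 1)\<close>. The two regimes correspond to the bounds \<open>h = 4 \<delta>\<^sup>2 k\<close> and \<open>h = 2 \<delta>\<close>.
  If \<open>m h = o(n log n)\<close> then the error of one test is at least \<open>n^(-o(1))\<close>, and since \<open>h \<ge> n^(-1/2)\<close>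
  the set \<open>S\<close> has size at least \<open>n^(1/2 - o(1))\<close>, so all tests succeed with probability at most
  \<open>exp (- n^(1/4))\<close>, even after a union bound over the \<open>k\<close> global shifts.
\<close>

section \<open>Distribution of the answers\<close>

text \<open>The likelihood of the answer \<open>a\<close> when the true label difference is
  \<open>c\<close>, meant for \<open>a < k\<close>. The difference is an unreduced integer, so that
  a difference of two labels can be inserted as it is.\<close>

definition answer_prob :: "nat \<Rightarrow> real \<Rightarrow> int \<Rightarrow> nat \<Rightarrow> real" where
  "answer_prob k \<delta> c a =
     (if int a = c mod int k then 1 / real k + \<delta> else 1 / real k - \<delta> / (real k - 1))"

text \<open>Among the noise values below \<open>k\<close> only the residue \<open>b\<close> of
  \<open>a - c\<close> leads from \<open>c\<close> to \<open>a\<close>, and \<open>b = 0\<close>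
  exactly when \<open>a\<close> and \<open>c\<close> are congruent.\<close>

lemma prob_noise_shift:
  assumes "2 \<le> k" "0 \<le> \<delta>" "\<delta> \<le> 1 - 1 / real k" "a < k"
  shows "measure_pmf.prob (noise_pmf k \<delta>) {\<eta>. nat ((c + int \<eta>) mod int k) = a} = answer_prob k \<delta> c a"
proof -
  define b where "b = nat ((int a - c) mod int k)"
  have b: "int b = (int a - c) mod int k" "b < k"
    using assms by (auto simp: b_def nat_less_iff)
  have supp: "set_pmf (noise_pmf k \<delta>) \<subseteq> {..<k}"
    using assms by (auto simp: set_pmf_iff pmf_noise_pmf split: if_splits)
  have iff: "nat ((c + int \<eta>) mod int k) = a \<longleftrightarrow> \<eta> = b" if "\<eta> < k" for \<eta>
  proof -
    have "nat ((c + int \<eta>) mod int k) = a \<longleftrightarrow> (c + int \<eta>) mod int k = int a mod int k"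
      using assms by (auto simp: nat_eq_iff)
    also have "\<dots> \<longleftrightarrow> int \<eta> mod int k = (int a - c) mod int k"
      unfolding mod_eq_dvd_iff by (simp add: algebra_simps)
    also have "\<dots> \<longleftrightarrow> \<eta> = b"
      using that b by auto
    finally show ?thesis .
  qed
  \<comment> \<open>The event on the left also contains \<open>b + k\<close>,
    \<open>b + 2 * k\<close> and so on. These have mass 0, so the two events agree only almost
    everywhere.\<close>
  have "measure_pmf.prob (noise_pmf k \<delta>) {\<eta>. nat ((c + int \<eta>) mod int k) = a} =
        measure_pmf.prob (noise_pmf k \<delta>) {b}"
    using supp iff b(2) by (intro measure_pmf.finite_measure_eq_AE) (auto simp: AE_measure_pmf_iff)
  also have "\<dots> = pmf (noise_pmf k \<delta>) b"
    by (simp add: measure_pmf_single)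
  also have "b = 0 \<longleftrightarrow> int a mod int k = c mod int k"
    unfolding mod_eq_dvd_iff using b(1) by (metis dvd_eq_mod_eq_0 of_nat_0_eq_iff)
  then have "pmf (noise_pmf k \<delta>) b = answer_prob k \<delta> c a"
    using assms b by (simp add: pmf_noise_pmf answer_prob_def)
  finally show ?thesis .
qed

lemma set_answers_pmf:
  assumes "2 \<le> k"
  shows "set_pmf (answers_pmf k \<delta> g Q) \<subseteq> PiE Q (\<lambda>_. {..<k})"
  using assms by (auto simp: answers_pmf_def measurement_def nat_less_iff)

text \<open>The noise vectors that produce the table \<open>f\<close> form a product event, with one
  condition per queried pair, so independence of the noise gives a product. Membership in
  \<open>PiE\<close> settles the values outside \<open>Q\<close>, where both tables are
  \<open>undefined\<close>.\<close>

lemma pmf_answers_pmf: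
  assumes "2 \<le> k" "0 \<le> \<delta>" "\<delta> \<le> 1 - 1 / real k" "finite Q" "f \<in> PiE Q (\<lambda>_. {..<k})"
  shows "pmf (answers_pmf k \<delta> g Q) f =
    (\<Prod>e\<in>Q. answer_prob k \<delta> (int (g (fst e)) - int (g (snd e))) (f e))"
proof -
  let ?B = "\<lambda>e. {\<eta>. nat ((int (g (fst e)) - int (g (snd e)) + int \<eta>) mod int k) = f e}"
  have "(\<lambda>\<eta>. restrict (measurement k g \<eta>) Q) -` {f} = Pi Q ?B"
    using assms(5) by (force simp: measurement_def PiE_def extensional_def fun_eq_iff restrict_def Pi_def)
  then have "pmf (answers_pmf k \<delta> g Q) f =
      measure_pmf.prob (Pi_pmf Q 0 (\<lambda>_. noise_pmf k \<delta>)) (Pi Q ?B)"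
    by (simp add: answers_pmf_def pmf_map)
  also have "\<dots> = (\<Prod>e\<in>Q. measure_pmf.prob (noise_pmf k \<delta>) (?B e))"
    using assms(4) by (rule measure_Pi_pmf_Pi)
  also have "\<dots> = (\<Prod>e\<in>Q. answer_prob k \<delta> (int (g (fst e)) - int (g (snd e))) (f e))"
    using assms by (intro prod.cong refl prob_noise_shift) auto
  finally show ?thesis .
qed

text \<open>A finite sum over answer tables separates the likelihood, which depends on
  \<open>g\<close>, from the decoder, which sees only \<open>f\<close>. This form later allows the
  sums over \<open>g\<close> and \<open>f\<close> to be swapped.\<close>

lemma prob_bind_answers_pmf:
  assumes "2 \<le> k" "0 \<le> \<delta>" "\<delta> \<le> 1 - 1 / real k" "finite Q"
  shows "measure_pmf.prob (bind_pmf (answers_pmf k \<delta> g Q) D) H =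
    (\<Sum>f\<in>PiE Q (\<lambda>_. {..<k}).
       (\<Prod>e\<in>Q. answer_prob k \<delta> (int (g (fst e)) - int (g (snd e))) (f e)) * measure_pmf.prob (D f) H)"
proof -
  have "measure_pmf.prob (bind_pmf (answers_pmf k \<delta> g Q) D) H =
      measure_pmf.expectation (answers_pmf k \<delta> g Q) (\<lambda>f. measure_pmf.prob (D f) H)"
    unfolding measure_pmf_bind
    by (rule measure_pmf.measure_bind[where N = "count_space UNIV"])
       (auto simp: space_subprob_algebra intro: prob_space_imp_subprob_space prob_space_measure_pmf)
  also have "\<dots> = (\<Sum>f\<in>PiE Q (\<lambda>_. {..<k}). pmf (answers_pmf k \<delta> g Q) f *\<^sub>R measure_pmf.prob (D f) H)"
    using set_answers_pmf[OF assms(1)] assms by (intro integral_measure_pmf finite_PiE) blast+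
  also have "\<dots> = (\<Sum>f\<in>PiE Q (\<lambda>_. {..<k}).
       (\<Prod>e\<in>Q. answer_prob k \<delta> (int (g (fst e)) - int (g (snd e))) (f e)) * measure_pmf.prob (D f) H)"
    using assms by (intro sum.cong) (auto simp: pmf_answers_pmf)
  finally show ?thesis .
qed

section \<open>Counting labelings up to a global shift\<close>

text \<open>For fixed \<open>h\<close> the shift determines \<open>g\<close>, because labels below
  \<open>k\<close> are determined by their residues. This is the source of the factor
  \<open>k\<close> in the final bound.\<close>

lemma card_equal_up_to_shift_le:
  assumes "G \<subseteq> PiE {1..n} (\<lambda>_. {..<k})"
  shows "card {g \<in> G. equal_up_to_shift n k g h} \<le> k"
proof -
  let ?X = "{g \<in> G. equal_up_to_shift n k g h}"
  have "\<forall>g\<in>?X. \<exists>\<alpha>. \<alpha> < k \<and> (\<forall>v\<in>{1..n}. h v = (g v + \<alpha>) mod k)"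
    by (auto simp: equal_up_to_shift_def)
  from bchoice[OF this] obtain \<alpha> where \<alpha>: "\<And>g. g \<in> ?X \<Longrightarrow> \<alpha> g < k"
    "\<And>g v. g \<in> ?X \<Longrightarrow> v \<in> {1..n} \<Longrightarrow> h v = (g v + \<alpha> g) mod k"
    by blast
  have "inj_on \<alpha> ?X"
  proof (rule inj_onI)
    fix g g' assume g: "g \<in> ?X" "g' \<in> ?X" and eq: "\<alpha> g = \<alpha> g'"
    show "g = g'"
    proof (rule PiE_ext)
      show "g \<in> PiE {1..n} (\<lambda>_. {..<k})" "g' \<in> PiE {1..n} (\<lambda>_. {..<k})"
        using g assms by auto
      fix v assume v: "v \<in> {1..n}"
      have "(g v + \<alpha> g) mod k = (g' v + \<alpha> g) mod k"
        using \<alpha>(2)[OF g(1) v] \<alpha>(2)[OF g(2) v] eq by simp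
      then have "g v mod k = g' v mod k"
        by (simp add: nat_mod_eq_iff)
      moreover have "g v < k" "g' v < k" using g assms v by (auto simp: PiE_iff)
      ultimately show "g v = g' v" by simp
    qed
  qed
  then have "card ?X \<le> card {..<k}"
    by (rule card_inj_on_le) (use \<alpha> in auto)
  then show ?thesis by simp
qed

text \<open>The left side is the expected number of labelings in \<open>G\<close> matched by a
  random output drawn from \<open>p\<close>, and every single output matches at most
  \<open>k\<close> of them.\<close>

lemma sum_prob_equal_up_to_shift_le:
  assumes "G \<subseteq> PiE {1..n} (\<lambda>_. {..<k})"
  shows "(\<Sum>g\<in>G. measure_pmf.prob p {h. equal_up_to_shift n k g h}) \<le> real k"
proof -
  have fin: "finite G" using assms by (rule finite_subset) (simp add: finite_PiE)
  have "(\<Sum>g\<in>G. measure_pmf.prob p {h. equal_up_to_shift n k g h}) =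
      (\<Sum>g\<in>G. measure_pmf.expectation p (indicator {h. equal_up_to_shift n k g h}))"
    by simp
  also have "\<dots> = measure_pmf.expectation p (\<lambda>h. \<Sum>g\<in>G. indicator {h. equal_up_to_shift n k g h} h)"
    by (subst Bochner_Integration.integral_sum)
       (auto intro!: measure_pmf.integrable_const_bound[where B = 1])
  also have "\<dots> = measure_pmf.expectation p (\<lambda>h. real (card {g \<in> G. equal_up_to_shift n k g h}))"
    by (intro Bochner_Integration.integral_cong refl) (auto simp: indicator_def fin sum.If_cases Int_def)
  also have "\<dots> \<le> measure_pmf.expectation p (\<lambda>h. real k)"
    by (rule integral_mono) (auto intro!: measure_pmf.integrable_const_bound[where B = "real k"]
        card_equal_up_to_shift_le[OF assms])
  finally show ?thesis by simp
qed

section \<open>Factorisation of sums over product spaces\<close>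

text \<open>A function on the union corresponds to the pair of its restrictions. The congruence
  hypotheses express that \<open>F\<close> depends only on the coordinates in \<open>A\<close> and
  \<open>G\<close> only on those in \<open>B\<close>, so both can be evaluated at functions with
  different domains.\<close>

lemma sum_PiE_Un:
  fixes F G :: "('a \<Rightarrow> 'b) \<Rightarrow> 'c :: comm_semiring_0"
  assumes "A \<inter> B = {}"
    and F: "\<And>f f'. (\<And>x. x \<in> A \<Longrightarrow> f x = f' x) \<Longrightarrow> F f = F f'"
    and G: "\<And>f f'. (\<And>x. x \<in> B \<Longrightarrow> f x = f' x) \<Longrightarrow> G f = G f'"
  shows "(\<Sum>f\<in>PiE (A \<union> B) K. F f * G f) = (\<Sum>f\<in>PiE A K. F f) * (\<Sum>f\<in>PiE B K. G f)"
proof -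
  have "(\<Sum>f\<in>PiE A K. F f) * (\<Sum>f\<in>PiE B K. G f) = (\<Sum>(f,f')\<in>PiE A K \<times> PiE B K. F f * G f')"
    by (simp add: sum_product sum.cartesian_product)
  also have "\<dots> = (\<Sum>f\<in>PiE (A \<union> B) K. F f * G f)"
  proof (rule sum.reindex_bij_witness[where
        i = "\<lambda>f. (restrict f A, restrict f B)" and j = "\<lambda>(f, f'). \<lambda>x. if x \<in> A then f x else f' x"])
    fix p assume p: "p \<in> PiE A K \<times> PiE B K"
    obtain f f' where [simp]: "p = (f, f')" by (cases p)
    show "(restrict ((\<lambda>(f, f'). \<lambda>x. if x \<in> A then f x else f' x) p) A,
           restrict ((\<lambda>(f, f'). \<lambda>x. if x \<in> A then f x else f' x) p) B) = p"
      using p assms(1) by (auto simp: fun_eq_iff restrict_def PiE_def extensional_def)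
    show "(\<lambda>(f, f'). \<lambda>x. if x \<in> A then f x else f' x) p \<in> PiE (A \<union> B) K"
      using p by (auto simp: PiE_iff extensional_def)
    have "F (\<lambda>x. if x \<in> A then f x else f' x) = F f"
      by (rule F) auto
    moreover have "G (\<lambda>x. if x \<in> A then f x else f' x) = G f'"
      by (rule G) (use assms(1) in auto)
    ultimately show "F ((\<lambda>(f, f'). \<lambda>x. if x \<in> A then f x else f' x) p) *
      G ((\<lambda>(f, f'). \<lambda>x. if x \<in> A then f x else f' x) p) = (case p of (f, f') \<Rightarrow> F f * G f')"
      by simp
  next
    fix f assume f: "f \<in> PiE (A \<union> B) K"
    show "(case (restrict f A, restrict f B) of (f, f') \<Rightarrow> \<lambda>x. if x \<in> A then f x else f' x) = f"
      using f by (auto simp: fun_eq_iff restrict_def PiE_def extensional_def)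
    show "(restrict f A, restrict f B) \<in> PiE A K \<times> PiE B K"
      using f by auto
  qed
  finally show ?thesis by simp
qed

text \<open>The distributive law for blocks of coordinates instead of single ones, by induction from
  the case of two blocks.\<close>

lemma sum_PiE_UN:
  fixes F :: "'i \<Rightarrow> ('a \<Rightarrow> 'b) \<Rightarrow> 'c :: comm_semiring_1"
  assumes "finite I" "disjoint_family_on B I"
    and dep: "\<And>i f f'. i \<in> I \<Longrightarrow> (\<And>x. x \<in> B i \<Longrightarrow> f x = f' x) \<Longrightarrow> F i f = F i f'"
  shows "(\<Sum>f\<in>PiE (\<Union>i\<in>I. B i) K. \<Prod>i\<in>I. F i f) = (\<Prod>i\<in>I. \<Sum>f\<in>PiE (B i) K. F i f)"
proof -
  \<comment> \<open>The induction runs over subsets \<open>J\<close> of \<open>I\<close>, so that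
    disjointness and \<open>dep\<close> can stay hypotheses about \<open>I\<close>.\<close>
  have "J \<subseteq> I \<Longrightarrow> (\<Sum>f\<in>PiE (\<Union>i\<in>J. B i) K. \<Prod>i\<in>J. F i f) = (\<Prod>i\<in>J. \<Sum>f\<in>PiE (B i) K. F i f)"
    if "finite J" for J
    using that
  proof (induction J rule: finite_induct)
    case empty
    show ?case by simp
  next
    case (insert i J)
    have "(\<Sum>f\<in>PiE (\<Union>j\<in>insert i J. B j) K. \<Prod>j\<in>insert i J. F j f) =
          (\<Sum>f\<in>PiE (B i \<union> (\<Union>j\<in>J. B j)) K. F i f * (\<Prod>j\<in>J. F j f))"
      by (simp only: prod.insert[OF insert.hyps] UN_insert)
    also have "\<dots> = (\<Sum>f\<in>PiE (B i) K. F i f) * (\<Sum>f\<in>PiE (\<Union>j\<in>J. B j) K. \<Prod>j\<in>J. F j f)"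
    proof (rule sum_PiE_Un)
      show "B i \<inter> (\<Union>j\<in>J. B j) = {}"
      proof -
        have "B i \<inter> B j = {}" if "j \<in> J" for j
          using that insert.hyps(2) insert.prems by (intro disjoint_family_onD[OF assms(2)]) auto
        then show ?thesis by auto
      qed
      show "F i f = F i f'" if "\<And>x. x \<in> B i \<Longrightarrow> f x = f' x" for f f'
        using insert.prems by (intro dep that) auto
      show "(\<Prod>j\<in>J. F j f) = (\<Prod>j\<in>J. F j f')" if "\<And>x. x \<in> (\<Union>j\<in>J. B j) \<Longrightarrow> f x = f' x" for f f'
        using insert.prems by (intro prod.cong refl dep that) auto
    qed
    also have "(\<Sum>f\<in>PiE (\<Union>j\<in>J. B j) K. \<Prod>j\<in>J. F j f) = (\<Prod>j\<in>J. \<Sum>f\<in>PiE (B j) K. F j f)"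
      using insert.prems by (intro insert.IH) auto
    finally show ?case
      by (simp only: prod.insert[OF insert.hyps])
  qed
  from this[OF assms(1) order_refl] show ?thesis .
qed

section \<open>Bhattacharyya bounds for testing between two product distributions\<close>

text \<open>Le Cam's inequality between the total variation affinity and the Bhattacharyya coefficient.\<close>

lemma sum_max_le:
  fixes p q :: "'a \<Rightarrow> real"
  assumes "\<And>x. x \<in> X \<Longrightarrow> 0 \<le> p x" "\<And>x. x \<in> X \<Longrightarrow> 0 \<le> q x"
    and "(\<Sum>x\<in>X. p x) = 1" "(\<Sum>x\<in>X. q x) = 1"
  shows "(\<Sum>x\<in>X. max (p x) (q x)) \<le> 2 - (\<Sum>x\<in>X. sqrt (p x * q x))\<^sup>2 / 2"
proof -
  have "(\<Sum>x\<in>X. max (p x) (q x)) + (\<Sum>x\<in>X. min (p x) (q x)) = (\<Sum>x\<in>X. p x + q x)"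
    unfolding sum.distrib[symmetric] by (intro sum.cong) auto
  then have eq: "(\<Sum>x\<in>X. max (p x) (q x)) = 2 - (\<Sum>x\<in>X. min (p x) (q x))"
    using assms by (simp add: sum.distrib)
  have min0: "0 \<le> (\<Sum>x\<in>X. min (p x) (q x))"
    using assms by (intro sum_nonneg) auto
  \<comment> \<open>Pointwise, the product of the two values is their minimum times their maximum.
    Cauchy-Schwarz then bounds the squared coefficient by the sum of minima times the sum of maxima,
    and the latter is at most 2.\<close>
  have "(\<Sum>x\<in>X. sqrt (p x * q x))\<^sup>2 = (\<Sum>x\<in>X. sqrt (min (p x) (q x)) * sqrt (max (p x) (q x)))\<^sup>2"
    by (intro arg_cong[where f = "\<lambda>x. x\<^sup>2"] sum.cong) (auto simp: real_sqrt_mult min_def max_def)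
  also have "\<dots> \<le> (\<Sum>x\<in>X. (sqrt (min (p x) (q x)))\<^sup>2) * (\<Sum>x\<in>X. (sqrt (max (p x) (q x)))\<^sup>2)"
    by (rule Cauchy_Schwarz_ineq_sum)
  also have "\<dots> = (\<Sum>x\<in>X. min (p x) (q x)) * (\<Sum>x\<in>X. max (p x) (q x))"
    using assms by (intro arg_cong2[where f = "(*)"] sum.cong) (auto simp: min_def max_def)
  also have "\<dots> \<le> (\<Sum>x\<in>X. min (p x) (q x)) * 2"
    using min0 eq by (intro mult_left_mono) auto
  finally show ?thesis using eq by linarith
qed

text \<open>The Bhattacharyya coefficient is multiplicative over coordinates, hence at least
  \<open>\<beta> ^ card B\<close>, and Le Cam's inequality squares it. Half of the left side is the
  success probability of the best test between the two products under a uniform prior.\<close>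

lemma sum_max_prod_le:
  fixes p q :: "'a \<Rightarrow> 'b \<Rightarrow> real"
  assumes "finite B" "finite K" "0 \<le> \<beta>"
    and p0: "\<And>e a. e \<in> B \<Longrightarrow> a \<in> K \<Longrightarrow> 0 \<le> p e a" and q0: "\<And>e a. e \<in> B \<Longrightarrow> a \<in> K \<Longrightarrow> 0 \<le> q e a"
    and p1: "\<And>e. e \<in> B \<Longrightarrow> (\<Sum>a\<in>K. p e a) = 1" and q1: "\<And>e. e \<in> B \<Longrightarrow> (\<Sum>a\<in>K. q e a) = 1"
    and \<beta>: "\<And>e. e \<in> B \<Longrightarrow> \<beta> \<le> (\<Sum>a\<in>K. sqrt (p e a * q e a))"
  shows "(\<Sum>f\<in>PiE B (\<lambda>_. K). max (\<Prod>e\<in>B. p e (f e)) (\<Prod>e\<in>B. q e (f e))) \<le> 2 - \<beta> ^ (2 * card B) / 2"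
proof -
  have fact: "(\<Sum>f\<in>PiE B (\<lambda>_. K). \<Prod>e\<in>B. r e (f e)) = (\<Prod>e\<in>B. \<Sum>a\<in>K. r e a)" for r :: "'a \<Rightarrow> 'b \<Rightarrow> real"
    using assms by (intro prod_sum_PiE[symmetric]) auto
  have sqrt_prod: "sqrt (\<Prod>e\<in>B. r e) = (\<Prod>e\<in>B. sqrt (r e))" for r :: "'a \<Rightarrow> real"
    by (induction B rule: infinite_finite_induct) (auto simp: real_sqrt_mult)
  have "\<beta> ^ card B \<le> (\<Prod>e\<in>B. \<Sum>a\<in>K. sqrt (p e a * q e a))"
    using assms by (subst prod_constant[symmetric], intro prod_mono) auto
  also have "\<dots> = (\<Sum>f\<in>PiE B (\<lambda>_. K). sqrt ((\<Prod>e\<in>B. p e (f e)) * (\<Prod>e\<in>B. q e (f e))))"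
    by (simp add: fact[symmetric] prod.distrib[symmetric] sqrt_prod)
  finally have "(\<beta> ^ card B)\<^sup>2 \<le> (\<Sum>f\<in>PiE B (\<lambda>_. K). sqrt ((\<Prod>e\<in>B. p e (f e)) * (\<Prod>e\<in>B. q e (f e))))\<^sup>2"
    using assms by (intro power_mono) auto
  moreover have "(\<Sum>f\<in>PiE B (\<lambda>_. K). max (\<Prod>e\<in>B. p e (f e)) (\<Prod>e\<in>B. q e (f e))) \<le>
     2 - (\<Sum>f\<in>PiE B (\<lambda>_. K). sqrt ((\<Prod>e\<in>B. p e (f e)) * (\<Prod>e\<in>B. q e (f e))))\<^sup>2 / 2"
    using p0 q0 p1 q1 by (intro sum_max_le) (auto simp: fact PiE_iff intro!: prod_nonneg)
  ultimately show ?thesis by (simp add: power_mult[symmetric] mult.commute)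
qed

lemma answer_prob_nonneg:
  assumes "2 \<le> k" "0 \<le> \<delta>" "\<delta> \<le> 1 - 1 / real k" "a < k"
  shows "0 \<le> answer_prob k \<delta> c a"
  using prob_noise_shift[OF assms] by (metis measure_nonneg)

lemma sum_answer_prob:
  assumes "2 \<le> k"
  shows "(\<Sum>a<k. answer_prob k \<delta> c a) = 1"
proof -
  define c' where "c' = nat (c mod int k)"
  have c': "int c' = c mod int k" "c' < k" using assms by (auto simp: c'_def nat_less_iff)
  have "(\<Sum>a<k. answer_prob k \<delta> c a) =
      answer_prob k \<delta> c c' + (\<Sum>a\<in>{..<k} - {c'}. answer_prob k \<delta> c a)"
    using c' by (intro sum.remove) auto
  also have "(\<Sum>a\<in>{..<k} - {c'}. answer_prob k \<delta> c a) =
      (\<Sum>a\<in>{..<k} - {c'}. 1 / real k - \<delta> / (real k - 1))"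
    using c' by (intro sum.cong refl) (auto simp: answer_prob_def simp flip: c'(1))
  also have "\<dots> = (real k - 1) * (1 / real k - \<delta> / (real k - 1))"
    using c' assms by (simp add: of_nat_diff)
  finally show ?thesis
    using assms c' by (simp add: answer_prob_def field_simps)
qed

text \<open>The two distributions differ only at the residues of \<open>c\<close> and
  \<open>d\<close>, where the values \<open>p\<close> and \<open>r\<close> are exchanged. The sum is
  therefore \<open>2 * sqrt (p * r) + (k - 2) * r\<close>, and \<open>p + (k - 1) * r = 1\<close>
  turns it into the Hellinger form.\<close>

lemma sum_sqrt_answer_prob:
  assumes "2 \<le> k" "0 \<le> \<delta>" "\<delta> \<le> 1 - 1 / real k" "c mod int k \<noteq> d mod int k"
  shows "(\<Sum>a<k. sqrt (answer_prob k \<delta> c a * answer_prob k \<delta> d a)) =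
    1 - (sqrt (1 / real k + \<delta>) - sqrt (1 / real k - \<delta> / (real k - 1)))\<^sup>2"
proof -
  define p where "p = 1 / real k + \<delta>"
  define r where "r = 1 / real k - \<delta> / (real k - 1)"
  define c' where "c' = nat (c mod int k)"
  define d' where "d' = nat (d mod int k)"
  have c': "int c' = c mod int k" "c' < k" using assms by (auto simp: c'_def nat_less_iff)
  have d': "int d' = d mod int k" "d' < k" using assms by (auto simp: d'_def nat_less_iff)
  have ne: "c' \<noteq> d'" using c' d' assms by auto
  \<comment> \<open>Reading \<open>r\<close> as the probability of the answer 0 at true difference 1
    yields \<open>0 \<le> r\<close>.\<close>
  have "answer_prob k \<delta> 1 0 = r" using assms by (simp add: answer_prob_def r_def)
  then have r0: "0 \<le> r" using answer_prob_nonneg[OF assms(1-3), of 0 1] assms by simp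
  have p0: "0 \<le> p" using assms by (simp add: p_def)
  let ?s = "\<lambda>a. sqrt (answer_prob k \<delta> c a * answer_prob k \<delta> d a)"
  have "(\<Sum>a<k. ?s a) = ?s c' + (\<Sum>a\<in>{..<k} - {c'}. ?s a)"
    using c' by (intro sum.remove) auto
  also have "(\<Sum>a\<in>{..<k} - {c'}. ?s a) = ?s d' + (\<Sum>a\<in>{..<k} - {c'} - {d'}. ?s a)"
    using d' ne by (intro sum.remove) auto
  also have "(\<Sum>a\<in>{..<k} - {c'} - {d'}. ?s a) = (\<Sum>a\<in>{..<k} - {c'} - {d'}. r)"
    using r0 by (intro sum.cong refl) (auto simp: answer_prob_def r_def simp flip: c'(1) d'(1))
  also have "\<dots> = (real k - 2) * r"
    using c' d' ne assms by (simp add: of_nat_diff)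
  also have "?s c' = sqrt (p * r)"
    using ne by (simp add: answer_prob_def p_def r_def flip: c'(1) d'(1))
  also have "?s d' = sqrt (p * r)"
    using ne by (auto simp: answer_prob_def p_def r_def mult.commute simp flip: c'(1) d'(1))
  finally have *: "(\<Sum>a<k. ?s a) = 2 * (sqrt p * sqrt r) + (real k - 2) * r"
    by (simp add: real_sqrt_mult)
  have "p + (real k - 1) * r = 1"
    using assms by (simp add: p_def r_def field_simps)
  moreover have "(sqrt p - sqrt r)\<^sup>2 = p + r - 2 * (sqrt p * sqrt r)"
    using p0 r0 by (simp add: power2_diff)
  ultimately have "(\<Sum>a<k. ?s a) = 1 - (sqrt p - sqrt r)\<^sup>2"
    unfolding * by (simp add: algebra_simps)
  then show ?thesis unfolding p_def r_def .
qed

section \<open>Low-degree independent sets in the query graph\<close>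

definition incident :: "(nat \<times> nat) set \<Rightarrow> nat \<Rightarrow> (nat \<times> nat) set" where
  "incident Q v = {e \<in> Q. fst e = v \<or> snd e = v}"

definition independent_in :: "(nat \<times> nat) set \<Rightarrow> nat set \<Rightarrow> bool" where
  "independent_in Q S \<longleftrightarrow> (\<forall>e\<in>Q. \<not> (fst e \<in> S \<and> snd e \<in> S))"

lemma valid_queries_subset: "valid_queries n Q \<Longrightarrow> Q \<subseteq> {1..n} \<times> {1..n}"
  by (auto simp: valid_queries_def)

lemma valid_queries_finite: "valid_queries n Q \<Longrightarrow> finite Q"
  by (rule finite_subset[OF valid_queries_subset]) auto

text \<open>Double counting: each query has at most two endpoints.\<close>

lemma sum_card_incident_le:
  assumes "finite Q" "finite V"
  shows "(\<Sum>v\<in>V. card (incident Q v)) \<le> 2 * card Q"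
proof -
  have "(\<Sum>v\<in>V. card (incident Q v)) = (\<Sum>v\<in>V. \<Sum>e\<in>Q. if fst e = v \<or> snd e = v then 1 else 0)"
    using assms by (simp add: incident_def sum.If_cases Int_def)
  also have "\<dots> = (\<Sum>e\<in>Q. \<Sum>v\<in>V. if fst e = v \<or> snd e = v then 1 else 0)"
    by (rule sum.swap)
  also have "\<dots> \<le> (\<Sum>e\<in>Q. 2)"
  proof (rule sum_mono)
    fix e assume "e \<in> Q"
    have "card {v \<in> V. fst e = v \<or> snd e = v} \<le> card {fst e, snd e}"
      by (intro card_mono) auto
    also have "\<dots> \<le> 2" by (simp add: card_insert_if)
    finally show "(\<Sum>v\<in>V. if fst e = v \<or> snd e = v then 1 else 0) \<le> (2 :: nat)"
      using assms by (simp add: sum.If_cases Int_def)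
  qed
  finally show ?thesis by simp
qed

text \<open>The degrees sum to at most \<open>2 * m\<close>, so at most half of the vertices have
  degree above \<open>D\<close>. The closed neighbourhoods of a maximal independent subset of the
  remaining vertices cover these vertices, and each has at most \<open>D + 1\<close>
  elements.\<close>

lemma ex_independent_low_degree:
  assumes valid: "valid_queries n Q" and m: "card Q \<le> m" and "n > 0"
    and D: "D = 4 * real m / real n"
  obtains S where "S \<subseteq> {1..n}" "independent_in Q S" "\<And>v. v \<in> S \<Longrightarrow> real (card (incident Q v)) \<le> D"
    "real n / 2 \<le> real (card S) * (D + 1)"
proof -
  define T where "T = {v \<in> {1..n}. real (card (incident Q v)) \<le> D}"
  have fin: "finite Q" using valid by (rule valid_queries_finite)
  have T: "T \<subseteq> {1..n}" "finite T" by (auto simp: T_def)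
  have D0: "D \<ge> 0" using D by simp
  have card_T: "real n / 2 \<le> real (card T)"
  \<comment> \<open>For \<open>m = 0\<close> the threshold \<open>D\<close> is 0, and the counting
    argument could not divide by it.\<close>
  proof (cases "m = 0")
    case True
    then have "Q = {}" using m fin by simp
    then have "T = {1..n}" using D0 by (auto simp: T_def incident_def)
    then show ?thesis by simp
  next
    case False
    then have "D > 0" using D assms(3) by simp
    have "real (card ({1..n} - T)) * D = (\<Sum>v\<in>{1..n} - T. D)" by simp
    also have "\<dots> \<le> (\<Sum>v\<in>{1..n} - T. real (card (incident Q v)))"
      by (intro sum_mono) (auto simp: T_def)
    also have "\<dots> \<le> real (2 * card Q)"
      using sum_card_incident_le[OF fin, of "{1..n} - T"] by (simp flip: of_nat_sum)
    also have "\<dots> \<le> 2 * real m" using m by simp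
    also have "\<dots> = real n / 2 * D" using D assms(3) by simp
    finally have "real (card ({1..n} - T)) \<le> real n / 2"
      using \<open>D > 0\<close> by simp
    moreover have "card ({1..n} - T) = n - card T" "card T \<le> n"
      using T card_mono[OF _ T(1)] by (auto simp: card_Diff_subset)
    ultimately show ?thesis by (simp add: of_nat_diff)
  qed
  let ?\<S> = "{S. S \<subseteq> T \<and> independent_in Q S}"
  have "finite ?\<S>" by (rule finite_subset[of _ "Pow T"]) (use T in auto)
  moreover have "?\<S> \<noteq> {}" by (auto simp: independent_in_def intro: exI[of _ "{}"])
  ultimately obtain S where S: "S \<in> ?\<S>" and "\<forall>S'\<in>?\<S>. S \<subseteq> S' \<longrightarrow> S = S'"
    by (rule bexE[OF finite_has_maximal])
  then have max: "\<And>S'. S' \<in> ?\<S> \<Longrightarrow> S \<subseteq> S' \<Longrightarrow> S = S'" by blast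
  \<comment> \<open>The closed neighbourhood of \<open>v\<close> in the query graph.\<close>
  define N where "N v = insert v ((\<lambda>e. if fst e = v then snd e else fst e) ` incident Q v)" for v
  have finI: "finite (incident Q v)" for v using fin by (simp add: incident_def)
  have "T \<subseteq> (\<Union>v\<in>S. N v)"
  proof
    fix w assume w: "w \<in> T"
    show "w \<in> (\<Union>v\<in>S. N v)"
    proof (cases "w \<in> S")
      case False
      then have "\<not> independent_in Q (insert w S)"
        using max[of "insert w S"] S w by auto
      then obtain e where e: "e \<in> Q" "fst e \<in> insert w S" "snd e \<in> insert w S"
        by (auto simp: independent_in_def)
      \<comment> \<open>Without loops, a query violating the independence of
        \<open>insert w S\<close> must join \<open>w\<close> to an element of
        \<open>S\<close>.\<close>
      have "fst e \<noteq> snd e" using e(1) valid by (auto simp: valid_queries_def)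
      moreover have "\<not> (fst e \<in> S \<and> snd e \<in> S)" using S e(1) by (auto simp: independent_in_def)
      ultimately consider "fst e = w" "snd e \<in> S" | "snd e = w" "fst e \<in> S" using e by auto
      then show ?thesis
      proof cases
        case 1
        then have "w \<in> N (snd e)"
          using e(1) \<open>fst e \<noteq> snd e\<close> by (force simp: N_def incident_def)
        then show ?thesis using 1 by auto
      next
        case 2
        then have "w \<in> N (fst e)"
          using e(1) by (force simp: N_def incident_def)
        then show ?thesis using 2 by auto
      qed
    qed (auto simp: N_def)
  qed
  moreover have finS: "finite S" using S T finite_subset by auto
  moreover have "finite (N v)" for v using finI by (simp add: N_def)
  ultimately have "card T \<le> card (\<Union>v\<in>S. N v)"
    by (intro card_mono) auto
  also have "\<dots> \<le> (\<Sum>v\<in>S. card (N v))"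
    using finS by (rule card_UN_le)
  finally have "real (card T) \<le> (\<Sum>v\<in>S. real (card (N v)))"
    by (simp flip: of_nat_sum)
  also have "\<dots> \<le> (\<Sum>v\<in>S. D + 1)"
  proof (rule sum_mono)
    fix v assume "v \<in> S"
    have "card (insert v A) \<le> Suc (card A)" for A
      by (cases "finite A") (simp_all add: card_insert_if)
    then have "card (N v) \<le> Suc (card ((\<lambda>e. if fst e = v then snd e else fst e) ` incident Q v))"
      unfolding N_def .
    also have "\<dots> \<le> Suc (card (incident Q v))"
      unfolding Suc_le_mono by (rule card_image_le[OF finI])
    finally have "card (N v) \<le> Suc (card (incident Q v))" .
    moreover have "real (card (incident Q v)) \<le> D" using \<open>v \<in> S\<close> S by (auto simp: T_def)
    ultimately show "real (card (N v)) \<le> D + 1" by linarith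
  qed
  finally have "real (card T) \<le> real (card S) * (D + 1)" by simp
  then show ?thesis
    using S T card_T by (intro that[of S]) (auto simp: T_def)
qed

section \<open>Average success for a fixed set of queries\<close>

text \<open>
  Fixing the labels outside an independent set \<open>S\<close> makes the answers at different vertices of \<open>S\<close>
  independent, so the maximum over the labels in \<open>S\<close> of the likelihood factorises.
\<close>

lemma sum_success_le:
  fixes n k :: nat and \<delta> \<beta> :: real
  assumes k: "2 \<le> k" "0 \<le> \<delta>" "\<delta> \<le> 1 - 1 / real k"
    and valid: "valid_queries n Q" and S: "S \<subseteq> {1..n}" "independent_in Q S"
    and \<beta>: "0 \<le> \<beta>" "\<beta> \<le> 1 - (sqrt (1 / real k + \<delta>) - sqrt (1 / real k - \<delta> / (real k - 1)))\<^sup>2"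
  shows "(\<Sum>g\<in>PiE {1..n} (\<lambda>_. {..<2}).
            measure_pmf.prob (bind_pmf (answers_pmf k \<delta> g Q) d) {h. equal_up_to_shift n k g h})
         \<le> 2 ^ n * (real k * (\<Prod>v\<in>S. 1 - \<beta> ^ (2 * card (incident Q v)) / 4))"
proof -
  define V where "V = {1..n}"
  define G where "G = PiE V (\<lambda>_. {..<2::nat})"
  define U where "U = PiE (V - S) (\<lambda>_. {..<2::nat})"
  define I where "I = incident Q"
  define Q0 where "Q0 = Q - (\<Union>v\<in>S. I v)"
  define R where "R = PiE Q (\<lambda>_. {..<k})"
  define L where "L g f = (\<Prod>e\<in>Q. answer_prob k \<delta> (int (g (fst e)) - int (g (snd e))) (f e))"
    for g :: "nat \<Rightarrow> nat" and f
  define m where "m f g = measure_pmf.prob (d f) {h. equal_up_to_shift n k g h}" for f g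
  \<comment> \<open>Here \<open>u\<close> stands for the revealed labels outside \<open>S\<close>.
    Overriding it at one \<open>v\<close> in \<open>S\<close> fixes both endpoints of every query at
    \<open>v\<close>, since the other endpoint lies outside \<open>S\<close>.\<close>
  define W where "W u v b e = answer_prob k \<delta> (int ((u(v := b)) (fst e)) - int ((u(v := b)) (snd e)))"
    for u :: "nat \<Rightarrow> nat" and v b :: nat and e
  define W0 where "W0 u e = answer_prob k \<delta> (int (u (fst e)) - int (u (snd e)))"
    for u :: "nat \<Rightarrow> nat" and e :: "nat \<times> nat"
  \<comment> \<open>The better of the two labels at \<open>v\<close>, judged by the answers at
    \<open>v\<close> alone. The product \<open>M\<close> built from it will dominate the likelihood
    of every labeling extending \<open>u\<close>.\<close>
  define X where "X u v f = max (\<Prod>e\<in>I v. W u v 0 e (f e)) (\<Prod>e\<in>I v. W u v 1 e (f e))" for u v f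
  define M where "M u f = (\<Prod>e\<in>Q0. W0 u e (f e)) * (\<Prod>v\<in>S. X u v f)" for u f
  define C where "C = (\<Prod>v\<in>S. 1 - \<beta> ^ (2 * card (I v)) / 4)"
  have finQ: "finite Q" using valid by (rule valid_queries_finite)
  have finI: "finite (I v)" for v using finQ by (simp add: I_def incident_def)
  have finS: "finite S" using S(1) finite_subset by auto
  have finQ0: "finite Q0" using finQ by (simp add: Q0_def)
  have finG: "finite G" by (simp add: G_def V_def finite_PiE)
  have finU: "finite U" by (simp add: U_def V_def finite_PiE)
  have finR: "finite R" using finQ by (simp add: R_def finite_PiE)
  have Qsub: "fst e \<in> V" "snd e \<in> V" "fst e \<noteq> snd e" if "e \<in> Q" for e
    using that valid by (auto simp: V_def valid_queries_def)
  have indep: "\<not> (fst e \<in> S \<and> snd e \<in> S)" if "e \<in> Q" for e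
    using that S(2) by (auto simp: independent_in_def)
  have disj: "disjoint_family_on I S"
    unfolding disjoint_family_on_def
  proof (intro ballI impI equals0I)
    fix v w e assume "v \<in> S" "w \<in> S" "v \<noteq> w" "e \<in> I v \<inter> I w"
    then show False using indep[of e] by (auto simp: I_def incident_def)
  qed
  have Qdec: "Q = Q0 \<union> (\<Union>v\<in>S. I v)" "Q0 \<inter> (\<Union>v\<in>S. I v) = {}"
    by (auto simp: Q0_def I_def incident_def)
  have W_nonneg: "0 \<le> W u v b e a" if "a < k" for u v b e a
    unfolding W_def using k that by (intro answer_prob_nonneg)
  have W0_nonneg: "0 \<le> W0 u e a" if "a < k" for u e a
    unfolding W0_def using k that by (intro answer_prob_nonneg)
  have f_less: "f e < k" if "f \<in> R" "e \<in> Q" for f e using that by (auto simp: R_def)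

  \<comment> \<open>Queries avoiding \<open>S\<close> have a likelihood depending on
    \<open>u\<close> only, and those at \<open>v\<close> in \<open>S\<close> depend on
    \<open>u\<close> and the single bit \<open>g v\<close>. Maximising over each bit separately
    gives the bound.\<close>
  have L_le: "L g f \<le> M u f" if g: "g \<in> G" "restrict g (V - S) = u" and f: "f \<in> R" for g u f
  proof -
    have ug: "u x = g x" if "x \<in> V" "x \<notin> S" for x using that g(2) by auto
    have "L g f = (\<Prod>e\<in>Q0. W0 g e (f e)) * (\<Prod>e\<in>(\<Union>v\<in>S. I v). W0 g e (f e))"
      unfolding L_def W0_def
      by (subst Qdec(1), rule prod.union_disjoint[OF finQ0 _ Qdec(2)]) (use finS finI in auto)
    also have "(\<Prod>e\<in>(\<Union>v\<in>S. I v). W0 g e (f e)) = (\<Prod>v\<in>S. \<Prod>e\<in>I v. W0 g e (f e))"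
      using finS finI disj by (intro prod.UNION_disjoint) (auto simp: disjoint_family_on_def)
    also have "(\<Prod>e\<in>Q0. W0 g e (f e)) = (\<Prod>e\<in>Q0. W0 u e (f e))"
    proof (rule prod.cong)
      fix e assume e: "e \<in> Q0"
      then have "e \<in> Q" "fst e \<notin> S" "snd e \<notin> S" by (auto simp: Q0_def I_def incident_def)
      then show "W0 g e (f e) = W0 u e (f e)" using Qsub by (simp add: W0_def ug)
    qed simp
    also have "(\<Prod>v\<in>S. \<Prod>e\<in>I v. W0 g e (f e)) = (\<Prod>v\<in>S. \<Prod>e\<in>I v. W u v (g v) e (f e))"
    proof (intro prod.cong refl)
      fix v e assume v: "v \<in> S" and "e \<in> I v"
      then have e: "e \<in> Q" "fst e = v \<or> snd e = v" by (auto simp: I_def incident_def)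
      show "W0 g e (f e) = W u v (g v) e (f e)"
        using e Qsub[OF e(1)] indep[OF e(1)] v by (auto simp: W0_def W_def ug)
    qed
    also have "(\<Prod>e\<in>Q0. W0 u e (f e)) * (\<Prod>v\<in>S. \<Prod>e\<in>I v. W u v (g v) e (f e)) \<le> M u f"
      unfolding M_def
    proof (intro mult_left_mono prod_mono conjI)
      fix v assume v: "v \<in> S"
      have "g v < 2" using g(1) v S(1) by (auto simp: G_def V_def)
      then have "g v = 0 \<or> g v = 1" by auto
      then show "(\<Prod>e\<in>I v. W u v (g v) e (f e)) \<le> X u v f" by (auto simp: X_def)
      show "0 \<le> (\<Prod>e\<in>I v. W u v (g v) e (f e))"
        using f by (intro prod_nonneg W_nonneg f_less) (auto simp: I_def incident_def)
    next
      show "0 \<le> (\<Prod>e\<in>Q0. W0 u e (f e))"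
        using f by (intro prod_nonneg ballI W0_nonneg f_less) (auto simp: Q0_def)
    qed
    finally show ?thesis .
  qed

  have X_nonneg: "0 \<le> X u v f" if "\<And>e. e \<in> I v \<Longrightarrow> f e < k" for u v f
    unfolding X_def using that by (intro max.coboundedI1 prod_nonneg W_nonneg)

  have X_cong: "X u v f = X u v f'" if "\<And>x. x \<in> I v \<Longrightarrow> f x = f' x" for u v f f'
    unfolding X_def using that by (intro arg_cong2[where f = max] prod.cong refl) simp_all

  \<comment> \<open>The sum over all answers splits into blocks. The block \<open>Q0\<close> has
    total mass 1, and the block at \<open>v\<close> contributes twice the success probability of the
    best binary test there, whence the power of 2.\<close>
  have sum_M: "(\<Sum>f\<in>R. M u f) \<le> 2 ^ card S * C" for u
  proof -
    have "(\<Sum>f\<in>R. M u f) = (\<Sum>f\<in>PiE (Q0 \<union> (\<Union>v\<in>S. I v)) (\<lambda>_. {..<k}). M u f)"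
      unfolding R_def using Qdec(1) by simp
    also have "\<dots> = (\<Sum>f\<in>PiE Q0 (\<lambda>_. {..<k}). \<Prod>e\<in>Q0. W0 u e (f e)) *
        (\<Sum>f\<in>PiE (\<Union>v\<in>S. I v) (\<lambda>_. {..<k}). \<Prod>v\<in>S. X u v f)"
      unfolding M_def
    proof (rule sum_PiE_Un[OF Qdec(2)])
      show "(\<Prod>e\<in>Q0. W0 u e (f e)) = (\<Prod>e\<in>Q0. W0 u e (f' e))" if "\<And>x. x \<in> Q0 \<Longrightarrow> f x = f' x" for f f'
        using that by (intro prod.cong) auto
      show "(\<Prod>v\<in>S. X u v f) = (\<Prod>v\<in>S. X u v f')" if "\<And>x. x \<in> (\<Union>v\<in>S. I v) \<Longrightarrow> f x = f' x" for f f'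
        using that by (intro prod.cong refl X_cong) blast
    qed
    also have "(\<Sum>f\<in>PiE Q0 (\<lambda>_. {..<k}). \<Prod>e\<in>Q0. W0 u e (f e)) = (\<Prod>e\<in>Q0. \<Sum>a<k. W0 u e a)"
      using finQ by (intro prod_sum_PiE[symmetric]) (auto simp: Q0_def)
    also have "\<dots> = 1"
      by (simp add: W0_def sum_answer_prob[OF k(1)])
    also have "(\<Sum>f\<in>PiE (\<Union>v\<in>S. I v) (\<lambda>_. {..<k}). \<Prod>v\<in>S. X u v f) =
        (\<Prod>v\<in>S. \<Sum>f\<in>PiE (I v) (\<lambda>_. {..<k}). X u v f)"
    proof (rule sum_PiE_UN[OF finS disj])
      show "X u v f = X u v f'" if "v \<in> S" "\<And>x. x \<in> I v \<Longrightarrow> f x = f' x" for v f f'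
        using that(2) by (rule X_cong)
    qed
    also have "\<dots> \<le> (\<Prod>v\<in>S. 2 * (1 - \<beta> ^ (2 * card (I v)) / 4))"
    proof (intro prod_mono conjI)
      fix v assume v: "v \<in> S"
      show "0 \<le> (\<Sum>f\<in>PiE (I v) (\<lambda>_. {..<k}). X u v f)"
        by (intro sum_nonneg X_nonneg) auto
      have "(\<Sum>f\<in>PiE (I v) (\<lambda>_. {..<k}). X u v f) \<le> 2 - \<beta> ^ (2 * card (I v)) / 2"
        unfolding X_def
      proof (rule sum_max_prod_le[OF finI _ \<beta>(1)])
        fix e assume "e \<in> I v"
        then have e: "e \<in> Q" "fst e = v \<or> snd e = v" by (auto simp: I_def incident_def)
        show "(\<Sum>a<k. W u v 0 e a) = 1" "(\<Sum>a<k. W u v 1 e a) = 1"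
          by (simp_all add: W_def sum_answer_prob[OF k(1)])
        \<comment> \<open>Changing the label at \<open>v\<close> from 0 to 1 moves the difference by
          1 or -1, which is nonzero modulo \<open>k\<close>. So the two hypotheses give distinct
          shifts of the noise.\<close>
        have "\<not> int k dvd 1" "\<not> int k dvd - 1" using k(1) by auto
        then have "(int ((u(v := 0)) (fst e)) - int ((u(v := 0)) (snd e))) mod int k \<noteq>
              (int ((u(v := 1)) (fst e)) - int ((u(v := 1)) (snd e))) mod int k"
          unfolding mod_eq_dvd_iff using e Qsub(3)[OF e(1)] by auto
        from sum_sqrt_answer_prob[OF k this] \<beta>(2)
        show "\<beta> \<le> (\<Sum>a<k. sqrt (W u v 0 e a * W u v 1 e a))"
          by (simp add: W_def)
      qed (auto intro: W_nonneg)
      then show "(\<Sum>f\<in>PiE (I v) (\<lambda>_. {..<k}). X u v f) \<le> 2 * (1 - \<beta> ^ (2 * card (I v)) / 4)"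
        by simp
    qed
    also have "\<dots> = 2 ^ card S * C"
      by (simp only: prod.distrib C_def prod_constant)
    finally show ?thesis by simp
  qed

  have M_nonneg: "0 \<le> M u f" if "f \<in> R" for u f
    unfolding M_def using that
    by (intro mult_nonneg_nonneg prod_nonneg ballI W0_nonneg X_nonneg f_less)
       (auto simp: Q0_def I_def incident_def)

  \<comment> \<open>Once the likelihood is replaced by \<open>M u f\<close>, which is common to the
    fibre, the remaining sum over \<open>g\<close> concerns one output distribution and is at most
    \<open>k\<close>.\<close>
  have fibre: "(\<Sum>g\<in>{g \<in> G. restrict g (V - S) = u}. \<Sum>f\<in>R. L g f * m f g) \<le> real k * (2 ^ card S * C)" for u
  proof -
    let ?G = "{g \<in> G. restrict g (V - S) = u}"
    have "?G \<subseteq> PiE {1..n} (\<lambda>_. {..<k})"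
      using k(1) PiE_mono[of V "\<lambda>_. {..<2}" "\<lambda>_. {..<k}"] by (auto simp: G_def V_def)
    then have m_le: "(\<Sum>g\<in>?G. m f g) \<le> real k" for f
      unfolding m_def by (rule sum_prob_equal_up_to_shift_le)
    have "(\<Sum>g\<in>?G. \<Sum>f\<in>R. L g f * m f g) \<le> (\<Sum>g\<in>?G. \<Sum>f\<in>R. M u f * m f g)"
      using L_le by (intro sum_mono mult_right_mono) (auto simp: m_def)
    also have "\<dots> = (\<Sum>f\<in>R. M u f * (\<Sum>g\<in>?G. m f g))"
      by (subst sum.swap) (simp add: sum_distrib_left)
    also have "\<dots> \<le> (\<Sum>f\<in>R. M u f * real k)"
      by (intro sum_mono mult_left_mono m_le M_nonneg)
    also have "\<dots> = real k * (\<Sum>f\<in>R. M u f)"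
      by (simp add: sum_distrib_left mult.commute)
    also have "\<dots> \<le> real k * (2 ^ card S * C)"
      by (intro mult_left_mono sum_M) auto
    finally show ?thesis .
  qed

  have "(\<Sum>g\<in>G. measure_pmf.prob (bind_pmf (answers_pmf k \<delta> g Q) d) {h. equal_up_to_shift n k g h}) =
      (\<Sum>g\<in>G. \<Sum>f\<in>R. L g f * m f g)"
    by (simp add: prob_bind_answers_pmf[OF k finQ] L_def m_def R_def)
  \<comment> \<open>Grouping by the restriction to \<open>V - S\<close> is the revealing of the
    labels outside \<open>S\<close>.\<close>
  also have "\<dots> = (\<Sum>u\<in>U. \<Sum>g\<in>{g \<in> G. restrict g (V - S) = u}. \<Sum>f\<in>R. L g f * m f g)"
    by (rule sum.group[symmetric]) (use finG finU in \<open>auto simp: G_def U_def\<close>)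
  also have "\<dots> \<le> (\<Sum>u\<in>U. real k * (2 ^ card S * C))"
    by (intro sum_mono fibre)
  also have "\<dots> = real (card U) * 2 ^ card S * (real k * C)"
    by simp
  also have "card U = 2 ^ (n - card S)"
    using S(1) finS by (simp add: U_def V_def card_PiE card_Diff_subset)
  also have "real (2 ^ (n - card S)) * 2 ^ card S = 2 ^ n"
    using card_mono[OF _ S(1)] by (simp flip: power_add)
  finally show ?thesis
    by (simp add: G_def V_def C_def I_def)
qed

section \<open>Randomised queries and the explicit bound\<close>

text \<open>A guarantee for every labeling implies one for the average over the \<open>2 ^ n\<close>
  labelings with values 0 and 1. Swapping this average with the random choice of queries leaves a
  bound that holds for each admissible \<open>Q\<close>.\<close>

lemma success_probability_le:
  assumes "2 \<le> k" "makes_at_most_queries n A m" "has_success_probability n k \<delta> A \<epsilon>"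
    and C: "\<And>Q d. valid_queries n Q \<Longrightarrow> card Q \<le> m \<Longrightarrow>
      (\<Sum>g\<in>PiE {1..n} (\<lambda>_. {..<2}).
         measure_pmf.prob (bind_pmf (answers_pmf k \<delta> g Q) d) {h. equal_up_to_shift n k g h}) \<le> 2 ^ n * C"
  shows "\<epsilon> \<le> C"
proof -
  let ?G = "PiE {1..n} (\<lambda>_. {..<2::nat})"
  define P where "P g Q = measure_pmf.prob (bind_pmf (answers_pmf k \<delta> g Q) (decoder A Q))
    {h. equal_up_to_shift n k g h}" for g Q
  have int: "integrable (query_dist A) (P g)" for g
    by (rule measure_pmf.integrable_const_bound[where B = 1]) (auto simp: P_def)
  have "2 ^ n * \<epsilon> = (\<Sum>g\<in>?G. \<epsilon>)"
    by (simp add: card_PiE)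
  also have "\<dots> \<le> (\<Sum>g\<in>?G. measure_pmf.prob (output_pmf k \<delta> A g) {h. equal_up_to_shift n k g h})"
  proof (rule sum_mono)
    fix g assume "g \<in> ?G"
    then have "g \<in> {1..n} \<rightarrow> {..<k}" using assms(1) by (auto simp: PiE_iff Pi_iff intro: less_le_trans)
    then show "\<epsilon> \<le> measure_pmf.prob (output_pmf k \<delta> A g) {h. equal_up_to_shift n k g h}"
      using assms(3) by (simp add: has_success_probability_def)
  qed
  also have "\<dots> = (\<Sum>g\<in>?G. measure_pmf.expectation (query_dist A) (P g))"
  proof (intro sum.cong refl)
    fix g
    show "measure_pmf.prob (output_pmf k \<delta> A g) {h. equal_up_to_shift n k g h} =
      measure_pmf.expectation (query_dist A) (P g)"
      unfolding output_pmf_def P_def measure_pmf_bind[of "query_dist A"]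
      by (rule measure_pmf.measure_bind[where N = "count_space UNIV"])
         (auto simp: space_subprob_algebra intro: prob_space_imp_subprob_space prob_space_measure_pmf)
  qed
  also have "\<dots> = measure_pmf.expectation (query_dist A) (\<lambda>Q. \<Sum>g\<in>?G. P g Q)"
    using int by (intro Bochner_Integration.integral_sum[symmetric])
  also have "\<dots> \<le> 2 ^ n * C"
  proof (rule measure_pmf.integral_le_const)
    show "integrable (query_dist A) (\<lambda>Q. \<Sum>g\<in>?G. P g Q)" using int by simp
    show "AE Q in query_dist A. (\<Sum>g\<in>?G. P g Q) \<le> 2 ^ n * C"
      using assms(2) C by (auto simp: AE_measure_pmf_iff makes_at_most_queries_def P_def)
  qed
  finally show ?thesis by simp
qed

text \<open>The bound for a fixed \<open>Q\<close> is applied with \<open>\<beta> = 1 - h\<close>.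
  Since \<open>1 - h \<ge> exp (- 2 * h)\<close>, each test errs with probability at least
  \<open>exp (- 4 * h * D) / 4\<close>, and \<open>1 - x \<le> exp (- x)\<close> turns the product
  over \<open>S\<close> into one exponential.\<close>

lemma success_probability_le_exp:
  fixes h D :: real
  assumes k: "2 \<le> k" "0 \<le> \<delta>" "\<delta> \<le> 1 - 1 / real k" and "n > 0"
    and h: "(sqrt (1 / real k + \<delta>) - sqrt (1 / real k - \<delta> / (real k - 1)))\<^sup>2 \<le> h" "h \<le> 1 / 2"
    and A: "makes_at_most_queries n A m" "has_success_probability n k \<delta> A \<epsilon>"
    and D: "D = 4 * real m / real n"
  shows "\<epsilon> \<le> real k * exp (- (real n / (8 * (D + 1)) * exp (- (4 * h * D))))"
proof (rule success_probability_le[OF k(1) A])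
  fix Q d assume Q: "valid_queries n Q" "card Q \<le> m"
  obtain S where S: "S \<subseteq> {1..n}" "independent_in Q S"
    and deg: "\<And>v. v \<in> S \<Longrightarrow> real (card (incident Q v)) \<le> D"
    and card: "real n / 2 \<le> real (card S) * (D + 1)"
    using ex_independent_low_degree[OF Q \<open>n > 0\<close> D] by blast
  have h0: "0 \<le> h" using h(1) by (rule order_trans[rotated]) simp
  have D0: "0 \<le> D" using D by simp
  \<comment> \<open>The assumption \<open>h \<le> 1 / 2\<close> gives
    \<open>2 * h ^ 2 \<le> h\<close>, which absorbs the quadratic term of the bound on the
    logarithm.\<close>
  have "- (2 * h) \<le> - h - 2 * h\<^sup>2"
    using h0 h(2) mult_left_mono[of "2 * h" 1 h] by (simp add: power2_eq_square)
  also have "\<dots> \<le> ln (1 - h)"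
    using h0 h(2) by (rule ln_one_minus_pos_lower_bound)
  finally have "exp (- (2 * h)) \<le> 1 - h"
    using h(2) by (simp add: ln_ge_iff)
  have *: "1 - (1 - h) ^ (2 * card (incident Q v)) / 4 \<le> exp (- (exp (- (4 * h * D)) / 4))"
    if "v \<in> S" for v
  proof -
    let ?c = "card (incident Q v)"
    have "exp (- (4 * h * D)) \<le> exp (- (4 * h * real ?c))"
      using deg[OF that] h0 by (simp add: mult_left_mono)
    also have "\<dots> = exp (- (2 * h)) ^ (2 * ?c)"
      by (simp flip: exp_of_nat_mult)
    also have "\<dots> \<le> (1 - h) ^ (2 * ?c)"
      using \<open>exp (- (2 * h)) \<le> 1 - h\<close> by (intro power_mono) auto
    finally have "1 - (1 - h) ^ (2 * ?c) / 4 \<le> 1 + (- (exp (- (4 * h * D)) / 4))" by simp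
    also have "\<dots> \<le> exp (- (exp (- (4 * h * D)) / 4))"
      by (rule exp_ge_add_one_self)
    finally show ?thesis .
  qed
  have "(\<Prod>v\<in>S. 1 - (1 - h) ^ (2 * card (incident Q v)) / 4) \<le> (\<Prod>v\<in>S. exp (- (exp (- (4 * h * D)) / 4)))"
  proof (intro prod_mono conjI *)
    fix v
    have "(1 - h) ^ (2 * card (incident Q v)) \<le> 1" using h0 h(2) by (intro power_le_one) auto
    then show "0 \<le> 1 - (1 - h) ^ (2 * card (incident Q v)) / 4" by simp
  qed
  also have "\<dots> = exp (- (real (card S) * (exp (- (4 * h * D)) / 4)))"
    by (simp flip: exp_of_nat_mult)
  also have "\<dots> \<le> exp (- (real n / (8 * (D + 1)) * exp (- (4 * h * D))))"
  proof -
    have "real n / (8 * (D + 1)) \<le> real (card S) / 4"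
      using card D0 by (simp add: field_simps)
    then have "real n / (8 * (D + 1)) * exp (- (4 * h * D)) \<le> real (card S) / 4 * exp (- (4 * h * D))"
      by (rule mult_right_mono) simp
    then show ?thesis by simp
  qed
  finally have prod: "(\<Prod>v\<in>S. 1 - (1 - h) ^ (2 * card (incident Q v)) / 4) \<le>
    exp (- (real n / (8 * (D + 1)) * exp (- (4 * h * D))))" .
  have "(\<Sum>g\<in>PiE {1..n} (\<lambda>_. {..<2}).
         measure_pmf.prob (bind_pmf (answers_pmf k \<delta> g Q) d) {h. equal_up_to_shift n k g h})
      \<le> 2 ^ n * (real k * (\<Prod>v\<in>S. 1 - (1 - h) ^ (2 * card (incident Q v)) / 4))"
    using h by (intro sum_success_le k Q S) auto
  also have "\<dots> \<le> 2 ^ n * (real k * exp (- (real n / (8 * (D + 1)) * exp (- (4 * h * D)))))"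
    using prod by (intro mult_left_mono) auto
  finally show "(\<Sum>g\<in>PiE {1..n} (\<lambda>_. {..<2}).
         measure_pmf.prob (bind_pmf (answers_pmf k \<delta> g Q) d) {h. equal_up_to_shift n k g h})
      \<le> 2 ^ n * (real k * exp (- (real n / (8 * (D + 1)) * exp (- (4 * h * D)))))" .
qed

section \<open>Hellinger distance between the noise and its shifts\<close>

text \<open>Both bounds come from \<open>(sqrt p - sqrt r) * (sqrt p + sqrt r) = p - r \<le> 2 *
  \<delta>\<close>. Comparing the two factors gives \<open>2 * \<delta>\<close>; squaring and
  dividing by the square of the second factor, which is at least \<open>1 / k\<close>, gives the
  other. They coincide at \<open>\<delta> = 1 / (2 * k)\<close>.\<close>

lemma hellinger_noise_le:
  fixes k :: nat and \<delta> :: real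
  assumes "2 \<le> k" "0 \<le> \<delta>" "\<delta> \<le> 1 - 1 / real k"
  shows "(sqrt (1 / real k + \<delta>) - sqrt (1 / real k - \<delta> / (real k - 1)))\<^sup>2 \<le> 4 * \<delta>\<^sup>2 * real k"
    and "(sqrt (1 / real k + \<delta>) - sqrt (1 / real k - \<delta> / (real k - 1)))\<^sup>2 \<le> 2 * \<delta>"
proof -
  define p where "p = 1 / real k + \<delta>"
  define r where "r = 1 / real k - \<delta> / (real k - 1)"
  have "answer_prob k \<delta> 1 0 = r" using assms by (simp add: answer_prob_def r_def)
  then have r0: "0 \<le> r" using answer_prob_nonneg[OF assms, of 0 1] assms by simp
  have p0: "0 < 1 / real k" "1 / real k \<le> p" using assms by (simp_all add: p_def)
  then have "0 < p" by linarith
  have "\<delta> / (real k - 1) \<le> \<delta> / 1" using assms by (intro divide_left_mono) auto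
  then have diff: "p - r \<le> 2 * \<delta>" by (simp add: p_def r_def)
  have "0 \<le> \<delta> / (real k - 1)" using assms by simp
  then have rp: "r \<le> p" using assms(2) unfolding p_def r_def by linarith
  have prod: "(sqrt p - sqrt r) * (sqrt p + sqrt r) = p - r"
    using \<open>0 < p\<close> r0 by (simp add: algebra_simps)
  have "(sqrt p - sqrt r)\<^sup>2 \<le> (sqrt p - sqrt r) * (sqrt p + sqrt r)"
    unfolding power2_eq_square using rp r0 by (intro mult_left_mono) auto
  then show "(sqrt (1 / real k + \<delta>) - sqrt (1 / real k - \<delta> / (real k - 1)))\<^sup>2 \<le> 2 * \<delta>"
    using prod diff unfolding p_def[symmetric] r_def[symmetric] by linarith
  have "1 / real k \<le> (sqrt p)\<^sup>2" using p0 \<open>0 < p\<close> by simp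
  also have "\<dots> \<le> (sqrt p + sqrt r)\<^sup>2" using \<open>0 < p\<close> r0 by (intro power_mono) auto
  finally have "(sqrt p - sqrt r)\<^sup>2 * (1 / real k) \<le> (sqrt p - sqrt r)\<^sup>2 * (sqrt p + sqrt r)\<^sup>2"
    by (rule mult_left_mono) simp
  also have "\<dots> = (p - r)\<^sup>2" by (simp add: prod flip: power_mult_distrib)
  also have "\<dots> \<le> (2 * \<delta>)\<^sup>2" using diff rp by (intro power_mono) auto
  finally have "(sqrt p - sqrt r)\<^sup>2 \<le> 4 * \<delta>\<^sup>2 * real k"
    using assms(1) by (simp add: field_simps)
  then show "(sqrt (1 / real k + \<delta>) - sqrt (1 / real k - \<delta> / (real k - 1)))\<^sup>2 \<le> 4 * \<delta>\<^sup>2 * real k"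
    unfolding p_def r_def .
qed

section \<open>Asymptotics and the two regimes\<close>

text \<open>Both regimes are instances that differ only in the Hellinger bound \<open>h\<close>. The
  lower bound on \<open>h\<close> keeps \<open>D\<close> below about the square root of
  \<open>n\<close>, so that polynomially many tests remain.\<close>

lemma eventually_success_probability_le:
  fixes k q :: "nat \<Rightarrow> nat" and \<delta> h :: "nat \<Rightarrow> real"
  assumes k: "\<forall>\<^sub>F n in sequentially. 2 \<le> k n \<and> real (k n) \<le> real n"
    and \<delta>: "\<forall>\<^sub>F n in sequentially. 0 \<le> \<delta> n \<and> \<delta> n \<le> 1 - 1 / real (k n)"
    and h: "\<forall>\<^sub>F n in sequentially.
      (sqrt (1 / real (k n) + \<delta> n) - sqrt (1 / real (k n) - \<delta> n / (real (k n) - 1)))\<^sup>2 \<le> h n \<and>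
      real n powr (- 1 / 2) \<le> h n \<and> h n \<le> 1 / 2"
    and q: "(\<lambda>n. real (q n)) \<in> o(\<lambda>n. real n * ln (real n) / h n)"
  shows "\<forall>\<^sub>F n in sequentially. \<forall>A \<epsilon>.
    makes_at_most_queries n A (q n) \<and> has_success_probability n (k n) (\<delta> n) A \<epsilon>
    \<longrightarrow> \<epsilon> \<le> exp (- (real n powr (1 / 4)))"
proof -
  \<comment> \<open>With the constant 1/256, the degree bound satisfies
    \<open>D \<le> ln n / (64 * h)\<close>. Hence \<open>4 * h * D \<le> ln n / 16\<close>, and the
    factor \<open>exp (- 4 * h * D)\<close> is at least \<open>n powr (- 1 / 16)\<close>.\<close>
  have q': "\<forall>\<^sub>F n in sequentially. norm (real (q n)) \<le> 1 / 256 * norm (real n * ln (real n) / h n)"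
    by (rule landau_o.smallD[OF q]) simp
  \<comment> \<open>The right side has order \<open>n powr (7 / 16) / ln n\<close>. The summand
    \<open>ln n\<close> on the left pays for the factor \<open>k \<le> n\<close> from the global
    shifts.\<close>
  have asymp: "\<forall>\<^sub>F n in sequentially. real n powr (1 / 4) + ln (real n) \<le>
      real n / (8 * (ln (real n) * real n powr (1 / 2) / 64 + 1)) * real n powr (- 1 / 16)"
    by real_asymp
  show ?thesis
    using k \<delta> h q' asymp eventually_gt_at_top[of 0]
  proof eventually_elim
    case (elim n)
    define D where "D = 4 * real (q n) / real n"
    have n: "real n \<ge> 1" using elim by linarith
    have h0: "h n > 0" using elim(3) n by (metis less_le_trans powr_gt_zero not_one_le_zero)
    have ln0: "ln (real n) \<ge> 0" using n by simp
    have "real (q n) \<le> 1 / 256 * (real n * ln (real n) / h n)"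
      using elim(4) n h0 ln0 by simp
    then have D_le: "D \<le> ln (real n) / h n / 64"
      using n h0 by (simp add: D_def field_simps)
    have "4 * h n * D \<le> 4 * h n * (ln (real n) / h n / 64)"
      using D_le h0 by (intro mult_left_mono) auto
    then have "4 * h n * D \<le> ln (real n) / 16" using h0 by simp
    moreover have "real n powr (- 1 / 16) = exp (- (ln (real n) / 16))"
      using n by (simp add: powr_def)
    ultimately have exp_ge: "real n powr (- 1 / 16) \<le> exp (- (4 * h n * D))" by simp
    have "1 / h n \<le> 1 / real n powr (- 1 / 2)"
      using elim(3) n h0 by (intro divide_left_mono) auto
    also have "\<dots> = real n powr (1 / 2)" by (simp add: powr_minus_divide)
    finally have "ln (real n) * (1 / h n) \<le> ln (real n) * real n powr (1 / 2)"
      using ln0 by (rule mult_left_mono)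
    then have D_le': "D \<le> ln (real n) * real n powr (1 / 2) / 64" using D_le by simp
    have D0: "D \<ge> 0" by (simp add: D_def)
    have "real n powr (1 / 4) + ln (real n) \<le>
      real n / (8 * (ln (real n) * real n powr (1 / 2) / 64 + 1)) * real n powr (- 1 / 16)"
      by (rule elim(5))
    also have "\<dots> \<le> real n / (8 * (D + 1)) * exp (- (4 * h n * D))"
      using D_le' D0 exp_ge n by (intro mult_mono divide_left_mono) auto
    finally have main: "ln (real n) - real n / (8 * (D + 1)) * exp (- (4 * h n * D)) \<le> - (real n powr (1 / 4))"
      by simp
    show ?case
    proof (intro allI impI, elim conjE)
      fix A \<epsilon> assume A: "makes_at_most_queries n A (q n)" "has_success_probability n (k n) (\<delta> n) A \<epsilon>"
      have "\<epsilon> \<le> real (k n) * exp (- (real n / (8 * (D + 1)) * exp (- (4 * h n * D))))"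
        using elim(1-3,6) A D_def by (intro success_probability_le_exp[where m = "q n"]) auto
      also have "\<dots> \<le> real n * exp (- (real n / (8 * (D + 1)) * exp (- (4 * h n * D))))"
        using elim(1) by (intro mult_right_mono) auto
      also have "\<dots> = exp (ln (real n) - real n / (8 * (D + 1)) * exp (- (4 * h n * D)))"
        using n by (simp add: exp_diff exp_minus field_simps)
      also have "\<dots> \<le> exp (- (real n powr (1 / 4)))"
        using main by simp
      finally show "\<epsilon> \<le> exp (- (real n powr (1 / 4)))" .
    qed
  qed
qed

text \<open>The growth condition on \<open>k\<close> is encoded by an exponent \<open>e\<close>
  tending to 0. The quantifiers over \<open>A\<close> and \<open>\<epsilon>\<close> stand inside the
  eventual statement, so one threshold for \<open>n\<close> serves all algorithms.\<close>

theorem theorem2: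
  fixes k :: "nat \<Rightarrow> nat" and \<delta> :: "nat \<Rightarrow> real" and e :: "nat \<Rightarrow> real" and q :: "nat \<Rightarrow> nat"
  assumes k_ge_2: "\<forall>\<^sub>F n in sequentially. k n \<ge> 2"
    and e: "e \<in> o(\<lambda>_. 1)"
    and k_le: "\<forall>\<^sub>F n in sequentially. real (k n) \<le> real n powr e n"
  shows
    "((\<forall>\<^sub>F n in sequentially. real n powr (- 1 / 4) \<le> \<delta> n \<and> \<delta> n \<le> 1 / (2 * real (k n)))
      \<and> (\<lambda>n. real (q n)) \<in> o(\<lambda>n. real n * ln (real n) / ((\<delta> n)\<^sup>2 * real (k n)))
      \<longrightarrow> (\<exists>c>0. \<forall>\<^sub>F n in sequentially. \<forall>A \<epsilon>.
             makes_at_most_queries n A (q n) \<and> has_success_probability n (k n) (\<delta> n) A \<epsilon>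
             \<longrightarrow> \<epsilon> \<le> exp (- (real n powr c))))
     \<and>
     ((\<forall>\<^sub>F n in sequentially. 1 / (2 * real (k n)) \<le> \<delta> n \<and> \<delta> n \<le> 1 / 4)
      \<and> (\<lambda>n. real (q n)) \<in> o(\<lambda>n. real n * ln (real n) / \<delta> n)
      \<longrightarrow> (\<exists>c>0. \<forall>\<^sub>F n in sequentially. \<forall>A \<epsilon>.
             makes_at_most_queries n A (q n) \<and> has_success_probability n (k n) (\<delta> n) A \<epsilon>
             \<longrightarrow> \<epsilon> \<le> exp (- (real n powr c))))"
proof -
  \<comment> \<open>The bound 1/2 on the exponent makes \<open>k\<close> at most the square root of
    \<open>n\<close>, which provides the lower bound on \<open>h\<close> in the second
    regime.\<close>
  have "\<forall>\<^sub>F n in sequentially. norm (e n) \<le> 1 / 2 * norm (1 :: real)"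
    by (rule landau_o.smallD[OF e]) simp
  with k_le have k_sqrt: "\<forall>\<^sub>F n in sequentially. real (k n) \<le> real n powr (1 / 2)"
    using eventually_gt_at_top[of 0]
  proof eventually_elim
    case (elim n)
    then have "real n powr e n \<le> real n powr (1 / 2)" by (intro powr_mono) auto
    with elim show ?case by linarith
  qed
  have k: "\<forall>\<^sub>F n in sequentially. 2 \<le> k n \<and> real (k n) \<le> real n"
    using k_ge_2 k_sqrt eventually_gt_at_top[of 0]
  proof eventually_elim
    case (elim n)
    then have "real n powr (1 / 2) \<le> real n powr 1" by (intro powr_mono) auto
    with elim show ?case by simp
  qed
  show ?thesis
  proof (intro conjI impI; elim conjE)
    assume \<delta>: "\<forall>\<^sub>F n in sequentially. real n powr (- 1 / 4) \<le> \<delta> n \<and> \<delta> n \<le> 1 / (2 * real (k n))"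
      and q: "(\<lambda>n. real (q n)) \<in> o(\<lambda>n. real n * ln (real n) / ((\<delta> n)\<^sup>2 * real (k n)))"
    have range: "\<forall>\<^sub>F n in sequentially. 0 \<le> \<delta> n \<and> \<delta> n \<le> 1 - 1 / real (k n)"
      using \<delta> k_ge_2
    proof eventually_elim
      case (elim n)
      have "0 \<le> \<delta> n" using elim(1) powr_ge_zero order_trans by blast
      moreover have "1 / (2 * real (k n)) \<le> 1 - 1 / real (k n)" using elim(2) by (simp add: field_simps)
      ultimately show ?case using elim(1) by linarith
    qed
    have "\<forall>\<^sub>F n in sequentially. \<forall>A \<epsilon>.
        makes_at_most_queries n A (q n) \<and> has_success_probability n (k n) (\<delta> n) A \<epsilon>
        \<longrightarrow> \<epsilon> \<le> exp (- (real n powr (1 / 4)))"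
    \<comment> \<open>For this \<open>h\<close>, \<open>\<delta> \<ge> n powr (- 1 / 4)\<close>
      gives the lower bound, while \<open>\<delta> * k \<le> 1 / 2\<close> and the resulting
      \<open>\<delta> \<le> 1 / 4\<close> give
      \<open>h \<le> 2 * \<delta> \<le> 1 / 2\<close>.\<close>
    proof (rule eventually_success_probability_le[where h = "\<lambda>n. 4 * (\<delta> n)\<^sup>2 * real (k n)", OF k range])
      show "\<forall>\<^sub>F n in sequentially.
        (sqrt (1 / real (k n) + \<delta> n) - sqrt (1 / real (k n) - \<delta> n / (real (k n) - 1)))\<^sup>2
          \<le> 4 * (\<delta> n)\<^sup>2 * real (k n) \<and>
        real n powr (- 1 / 2) \<le> 4 * (\<delta> n)\<^sup>2 * real (k n) \<and> 4 * (\<delta> n)\<^sup>2 * real (k n) \<le> 1 / 2"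
        using \<delta> range k_ge_2
      proof eventually_elim
        case (elim n)
        have "(real n powr (- 1 / 4))\<^sup>2 \<le> (\<delta> n)\<^sup>2" using elim by (intro power_mono) auto
        then have sq: "real n powr (- 1 / 2) \<le> (\<delta> n)\<^sup>2"
          by (simp add: power2_eq_square flip: powr_add)
        have "1 * (\<delta> n)\<^sup>2 \<le> (4 * real (k n)) * (\<delta> n)\<^sup>2" using elim by (intro mult_right_mono) auto
        then have lower: "real n powr (- 1 / 2) \<le> 4 * (\<delta> n)\<^sup>2 * real (k n)"
          using sq by (simp add: mult_ac)
        have "\<delta> n * real (k n) \<le> 1 / 2"
          using elim by (simp add: field_simps)
        then have "4 * \<delta> n * (\<delta> n * real (k n)) \<le> 4 * \<delta> n * (1 / 2)"
          using elim by (intro mult_left_mono) auto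
        also have "\<delta> n \<le> 1 / 4"
        proof -
          have "1 / (2 * real (k n)) \<le> 1 / 4" using elim(3) by (intro divide_left_mono) auto
          then show ?thesis using elim(1) by linarith
        qed
        finally have "4 * (\<delta> n)\<^sup>2 * real (k n) \<le> 1 / 2" by (simp add: power2_eq_square mult_ac)
        then show ?case using lower hellinger_noise_le(1)[of "k n" "\<delta> n"] elim by simp
      qed
      have "(\<lambda>n. real (q n)) \<in> o(\<lambda>n. 1 / 4 * (real n * ln (real n) / ((\<delta> n)\<^sup>2 * real (k n))))"
        using q by (subst landau_o.small.cmult) auto
      then show "(\<lambda>n. real (q n)) \<in> o(\<lambda>n. real n * ln (real n) / (4 * (\<delta> n)\<^sup>2 * real (k n)))"
        by (simp add: mult_ac)
    qed
    then show "\<exists>c>0. \<forall>\<^sub>F n in sequentially. \<forall>A \<epsilon>.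
        makes_at_most_queries n A (q n) \<and> has_success_probability n (k n) (\<delta> n) A \<epsilon>
        \<longrightarrow> \<epsilon> \<le> exp (- (real n powr c))"
      by (intro exI[of _ "1 / 4"] conjI) simp_all
  next
    assume \<delta>: "\<forall>\<^sub>F n in sequentially. 1 / (2 * real (k n)) \<le> \<delta> n \<and> \<delta> n \<le> 1 / 4"
      and q: "(\<lambda>n. real (q n)) \<in> o(\<lambda>n. real n * ln (real n) / \<delta> n)"
    have range: "\<forall>\<^sub>F n in sequentially. 0 \<le> \<delta> n \<and> \<delta> n \<le> 1 - 1 / real (k n)"
      using \<delta> k_ge_2
    proof eventually_elim
      case (elim n)
      have "0 \<le> 1 / (2 * real (k n))" by simp
      moreover have "1 / 4 \<le> 1 - 1 / real (k n)" using elim(2) by (simp add: field_simps)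
      ultimately show ?case using elim(1) by linarith
    qed
    have "\<forall>\<^sub>F n in sequentially. \<forall>A \<epsilon>.
        makes_at_most_queries n A (q n) \<and> has_success_probability n (k n) (\<delta> n) A \<epsilon>
        \<longrightarrow> \<epsilon> \<le> exp (- (real n powr (1 / 4)))"
    \<comment> \<open>For this \<open>h\<close>, \<open>\<delta> \<ge> 1 / (2 * k)\<close> gives
      \<open>h \<ge> 1 / k \<ge> n powr (- 1 / 2)\<close>, and \<open>\<delta> \<le> 1 / 4\<close>
      gives the upper bound.\<close>
    proof (rule eventually_success_probability_le[where h = "\<lambda>n. 2 * \<delta> n", OF k range])
      show "\<forall>\<^sub>F n in sequentially.
        (sqrt (1 / real (k n) + \<delta> n) - sqrt (1 / real (k n) - \<delta> n / (real (k n) - 1)))\<^sup>2 \<le> 2 * \<delta> n \<and>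
        real n powr (- 1 / 2) \<le> 2 * \<delta> n \<and> 2 * \<delta> n \<le> 1 / 2"
        using \<delta> range k_ge_2 k_sqrt eventually_gt_at_top[of 0]
      proof eventually_elim
        case (elim n)
        have "real n powr (- 1 / 2) = 1 / real n powr (1 / 2)"
          by (simp add: powr_minus_divide)
        also have "\<dots> \<le> 1 / real (k n)"
          using elim by (intro divide_left_mono) auto
        also have "\<dots> \<le> 2 * \<delta> n" using elim(1,3) by (simp add: field_simps)
        finally show ?case using hellinger_noise_le(2)[of "k n" "\<delta> n"] elim by simp
      qed
      have "(\<lambda>n. real (q n)) \<in> o(\<lambda>n. 1 / 2 * (real n * ln (real n) / \<delta> n))"
        using q by (subst landau_o.small.cmult) auto
      then show "(\<lambda>n. real (q n)) \<in> o(\<lambda>n. real n * ln (real n) / (2 * \<delta> n))"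
        by (simp add: mult_ac)
    qed
    then show "\<exists>c>0. \<forall>\<^sub>F n in sequentially. \<forall>A \<epsilon>.
        makes_at_most_queries n A (q n) \<and> has_success_probability n (k n) (\<delta> n) A \<epsilon>
        \<longrightarrow> \<epsilon> \<le> exp (- (real n powr c))"
      by (intro exI[of _ "1 / 4"] conjI) simp_all
  qed
qed

end
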